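(* Let $n\ge 2$, let $q$ be a power of a prime $p$, and let $\mathcal{S}:F(X_0,\dots,X_n)=0\subset\mathbb{P}^n$ be a smooth absolutely irreducible hypersurface of degree $d>2$, where $F\in\mathbb{F}_q[X_0,\dots,X_n]$ is a homogeneous polynomial of the form $$F(X_0,\dots,X_n)=G(X_0,\dots,X_{n-1})-X_n^d,$$ and suppose that $p\nmid d$ and that $\sum_{i=0}^n\frac{\partial F}{\partial X_i}X_i^q$ is a nonzero polynomial. Then $\mathcal{S}$ is $\mathbb{F}_q$-Frobenius nonclassical if and only if there exists a positive integer $k$ such that $kd=d-1+q$ with $p\mid k$ and $$G^k=\sum_{i=0}^{n-1}G_iX_i^q,\qquad\text{where } G_i=\partial G/\partial X_i.$$ In particular, in this case $\mathcal{V}:G=0\subset\mathbb{P}^{n-1}$ is $\mathbb{F}_q$-Frobenius nonclassical as well.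
   Context: $\Phi_q$ is the $\mathbb{F}_q$-Frobenius map (raising coordinates to the $q$-th power). A hypersurface $\mathcal{S}$ over $\mathbb{F}_q$ defined by a homogeneous polynomial $F$ is $\mathbb{F}_q$-Frobenius nonclassical if $\Phi_q(P)\in T_P(\mathcal{S})$ for every nonsingular point $P$ of $\mathcal{S}$, where $T_P(\mathcal{S})$ is the tangent hyperplane; equivalently, if $F$ divides $\sum_i\frac{\partial F}{\partial X_i}X_i^q$. *)

theory Defs
  imports
    "HOL-Library.Poly_Mapping"
    "HOL-Library.Cardinality"
    "HOL-Algebra.Algebraic_Closure_Type"
begin

section \<open>Multivariate polynomials\<close>

text \<open>
  Polynomials in the variables \<open>X\<^sub>0, X\<^sub>1, \<dots>\<close> are finitely supported maps from exponent vectors to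
  coefficients; ring structure and divisibility are those of \<open>Poly_Mapping\<close>. The polynomials in
  \<open>X\<^sub>0, \<dots>, X\<^sub>N\<close> are those whose variables lie in \<open>{..N}\<close>.
\<close>

type_synonym 'a mpoly = "(nat \<Rightarrow>\<^sub>0 nat) \<Rightarrow>\<^sub>0 'a"

definition mvar :: "nat \<Rightarrow> 'a::zero_neq_one mpoly" where
  "mvar i = Poly_Mapping.single (Poly_Mapping.single i 1) 1"

definition mvars :: "'a::zero mpoly \<Rightarrow> nat set" where
  "mvars F = (\<Union>m\<in>Poly_Mapping.keys F. Poly_Mapping.keys m)"

definition mhomogeneous :: "nat \<Rightarrow> 'a::zero mpoly \<Rightarrow> bool" where
  "mhomogeneous d F \<longleftrightarrow>
    (\<forall>m\<in>Poly_Mapping.keys F. (\<Sum>i\<in>Poly_Mapping.keys m. Poly_Mapping.lookup m i) = d)"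

definition meval :: "(nat \<Rightarrow> 'a) \<Rightarrow> 'a::comm_semiring_1 mpoly \<Rightarrow> 'a" where
  "meval x F = (\<Sum>m\<in>Poly_Mapping.keys F. Poly_Mapping.lookup F m *
      (\<Prod>i\<in>Poly_Mapping.keys m. x i ^ Poly_Mapping.lookup m i))"

text \<open>
  Formal partial derivative. The subtraction of exponents is truncated, but a monomial in which
  \<open>X\<^sub>i\<close> does not occur gets coefficient zero.
\<close>

definition mpderiv :: "nat \<Rightarrow> 'a::comm_semiring_1 mpoly \<Rightarrow> 'a mpoly" where
  "mpderiv i F = (\<Sum>m\<in>Poly_Mapping.keys F.
      Poly_Mapping.single (m - Poly_Mapping.single i 1)
        (of_nat (Poly_Mapping.lookup m i) * Poly_Mapping.lookup F m))"

definition mto_ac :: "'a::field mpoly \<Rightarrow> 'a alg_closure mpoly" where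
  "mto_ac F = Poly_Mapping.map to_ac F"

definition absolutely_irreducible :: "'a::field mpoly \<Rightarrow> bool" where
  "absolutely_irreducible F \<longleftrightarrow> Factorial_Ring.irreducible (mto_ac F)"


section \<open>Projective hypersurfaces\<close>

text \<open>
  A point of \<open>\<bbbP>\<^sup>N\<close> is given by any of its vectors of homogeneous coordinates \<open>x\<^sub>0, \<dots>, x\<^sub>N\<close>, not all
  zero; coordinates beyond \<open>N\<close> are set to zero. Every condition imposed on points below is
  invariant under rescaling when \<open>F\<close> is homogeneous. The points of a hypersurface over a field
  \<open>K\<close> are its geometric points, i.e. points over the algebraic closure of \<open>K\<close>.
\<close>

definition proj_coords :: "nat \<Rightarrow> (nat \<Rightarrow> 'a::zero) set" where
  "proj_coords N = {x. (\<exists>i\<le>N. x i \<noteq> 0) \<and> (\<forall>i>N. x i = 0)}"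

definition hypersurface :: "nat \<Rightarrow> 'a::field mpoly \<Rightarrow> (nat \<Rightarrow> 'a alg_closure) set" where
  "hypersurface N F = {x \<in> proj_coords N. meval x (mto_ac F) = 0}"

definition nonsingular_at :: "nat \<Rightarrow> 'a::field mpoly \<Rightarrow> (nat \<Rightarrow> 'a alg_closure) \<Rightarrow> bool" where
  "nonsingular_at N F x \<longleftrightarrow> (\<exists>i\<le>N. meval x (mpderiv i (mto_ac F)) \<noteq> 0)"

definition smooth_hypersurface :: "nat \<Rightarrow> 'a::field mpoly \<Rightarrow> bool" where
  "smooth_hypersurface N F \<longleftrightarrow> (\<forall>x\<in>hypersurface N F. nonsingular_at N F x)"

definition tangent_hyperplane ::
    "nat \<Rightarrow> 'a::field mpoly \<Rightarrow> (nat \<Rightarrow> 'a alg_closure) \<Rightarrow> (nat \<Rightarrow> 'a alg_closure) set" where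
  "tangent_hyperplane N F x =
    {y \<in> proj_coords N. (\<Sum>i\<le>N. meval x (mpderiv i (mto_ac F)) * y i) = 0}"

definition frobenius_map :: "nat \<Rightarrow> (nat \<Rightarrow> 'a::power) \<Rightarrow> (nat \<Rightarrow> 'a)" where
  "frobenius_map q x = (\<lambda>i. x i ^ q)"

text \<open>The parameter \<open>q\<close> is the order of the base field.\<close>

definition frobenius_nonclassical :: "nat \<Rightarrow> nat \<Rightarrow> 'a::field mpoly \<Rightarrow> bool" where
  "frobenius_nonclassical q N F \<longleftrightarrow>
    (\<forall>x\<in>hypersurface N F. nonsingular_at N F x \<longrightarrow> frobenius_map q x \<in> tangent_hyperplane N F x)"

end

theory Submission
  imports Defs
begin

text \<open>
  The hypersurface \<open>F = G - X\<^sub>n\<^sup>d = 0\<close> is a cyclic cover of degree \<open>d\<close> of projective space, branched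
  along \<open>G = 0\<close>. Write \<open>A = \<Sum>\<^bsub>i<n\<^esub> G\<^sub>i X\<^sub>i\<^sup>q\<close>. Since \<open>\<partial>F/\<partial>X\<^sub>n = - d X\<^sub>n\<^bsup>d-1\<^esup>\<close>, the Frobenius image of a
  point \<open>x\<close> lies on the tangent hyperplane exactly when \<open>A(x) = d x\<^sub>n\<^bsup>d-1+q\<^esup>\<close>
  (\<open>frobenius_tangent_sum_cyclic_cover\<close>).

  Suppose this holds on the whole cover. The left hand side does not see \<open>x\<^sub>n\<close>, so over a base point
  with \<open>G(x) \<noteq> 0\<close> the \<open>d\<close> distinct \<open>d\<close>-th roots of \<open>G(x)\<close> all have the same power of exponent
  \<open>d - 1 + q\<close>. This forces \<open>d - 1 + q = k d\<close>, and then \<open>A = d G\<^sup>k\<close> as functions, hence as polynomials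
  (\<open>eq_power_if_on_cyclic_cover\<close>).

  It remains to see that \<open>d = 1\<close> in the base field, for then \<open>A = G\<^sup>k\<close>, and \<open>p\<close> divides \<open>d - 1 + q = k d\<close>
  but not \<open>d\<close>, so it divides \<open>k\<close>. This is \<open>degree_eq_1_mod_char\<close>, proved by looking at rational points
  \<open>b\<close>, where \<open>b\<^sub>i\<^sup>q = b\<^sub>i\<close> turns \<open>A\<close> into the sum in Euler's identity. Assume \<open>d \<noteq> 1\<close>.

  \<^item> If \<open>G(b) = 0\<close>, differentiate \<open>A = d G\<^sup>k\<close> with respect to \<open>X\<^sub>j\<close>. The powers \<open>X\<^sub>i\<^sup>q\<close> are constants for the
    derivation and \<open>k \<ge> 2\<close>, so \<open>\<Sum>\<^sub>i G\<^sub>i\<^sub>j(b) b\<^sub>i = 0\<close>. By Euler's identity for \<open>G\<^sub>j\<close> this sum is \<open>(d - 1) G\<^sub>j(b)\<close>.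
    So all \<open>G\<^sub>j\<close> vanish at \<open>b\<close>, and the point of the cover above \<open>b\<close> is singular.
  \<^item> Hence \<open>G(b) \<noteq> 0\<close> at every rational \<open>b \<noteq> 0\<close>, and \<open>d G(b) = A(b) = d G(b)\<^sup>k\<close> gives
    \<open>G(b)\<^bsup>k-1\<^esup> = 1\<close>. But \<open>G\<^bsup>k-1\<^esup>\<close> has degree \<open>q - 1\<close>, too small for it to take the value 1
    at all \<open>q\<close> affine points of a rational line and at its point at infinity
    (\<open>exists_rational_point_power_neq_1\<close>).

  Conversely, \<open>p dvd k\<close> gives \<open>d = 1\<close> in the base field, and on the cover
  \<open>A(x) = G(x)\<^sup>k = x\<^sub>n\<^bsup>k d\<^esup> = d x\<^sub>n\<^bsup>d-1+q\<^esup>\<close>. Finally \<open>A = G\<^sup>k\<close> vanishes wherever \<open>G\<close> does, which is the claim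
  about \<open>G = 0\<close>.
\<close>

section \<open>Evaluation, differentiation and base change\<close>

lemma mpoly_induct [case_names single add]:
  assumes "\<And>m c. P (Poly_Mapping.single m c)"
    and "\<And>F G. P F \<Longrightarrow> P G \<Longrightarrow> P (F + G)"
  shows "P (F :: 'a::comm_monoid_add mpoly)"
proof (induction F rule: Poly_Mapping.update_induct)
  case const
  then show ?case using assms(1)[of 0 0] by simp
next
  case (update F m c)
  have "Poly_Mapping.update m c F = F + Poly_Mapping.single m c"
    using update(1)
    by (intro poly_mapping_eqI)
      (auto simp: lookup_update lookup_add lookup_single when_def in_keys_iff)
  then show ?case using assms update by simp
qed

text \<open>
  The value of a monomial is kept apart from its coefficient because it is multiplicative in the
  monomial and in the point: the first makes evaluation a ring homomorphism, the second
  makes monomials characters, hence linearly independent.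
\<close>

definition mmon :: "(nat \<Rightarrow> 'a::comm_semiring_1) \<Rightarrow> (nat \<Rightarrow>\<^sub>0 nat) \<Rightarrow> 'a" where
  "mmon x m = (\<Prod>i\<in>Poly_Mapping.keys m. x i ^ Poly_Mapping.lookup m i)"

lemma mmon_superset:
  assumes "finite A" "Poly_Mapping.keys m \<subseteq> A"
  shows "mmon x m = (\<Prod>i\<in>A. x i ^ Poly_Mapping.lookup m i)"
  unfolding mmon_def using assms
  by (intro prod.mono_neutral_left) (auto simp: in_keys_iff)

lemma mmon_0 [simp]: "mmon x 0 = 1"
  by (simp add: mmon_def)

lemma mmon_add: "mmon x (m + m') = mmon x m * mmon x m'"
proof -
  let ?A = "Poly_Mapping.keys m \<union> Poly_Mapping.keys m'"
  have "mmon x (m + m') = (\<Prod>i\<in>?A. x i ^ Poly_Mapping.lookup (m + m') i)"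
    using keys_add[of m m'] by (intro mmon_superset) auto
  also have "\<dots> = mmon x m * mmon x m'"
    by (simp add: mmon_superset[of ?A] lookup_add power_add prod.distrib)
  finally show ?thesis .
qed

lemma mmon_mult: "mmon (\<lambda>i. x i * y i) m = mmon x m * mmon y m"
  by (simp add: mmon_def power_mult_distrib prod.distrib)

lemma mmon_const_1 [simp]: "mmon (\<lambda>i. 1) m = 1"
  by (simp add: mmon_def)

lemma mmon_fun_upd: "mmon ((\<lambda>i. 1)(j := t)) m = t ^ Poly_Mapping.lookup m j"
proof -
  have "mmon ((\<lambda>i. 1)(j := t)) m =
      (\<Prod>i\<in>insert j (Poly_Mapping.keys m). ((\<lambda>i. 1)(j := t)) i ^ Poly_Mapping.lookup m i)"
    by (intro mmon_superset) auto
  also have "\<dots> = t ^ Poly_Mapping.lookup m j"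
    by (simp add: prod.insert_remove)
  finally show ?thesis .
qed

lemma meval_conv_mmon:
  "meval x F = (\<Sum>m\<in>Poly_Mapping.keys F. Poly_Mapping.lookup F m * mmon x m)"
  by (simp add: meval_def mmon_def)

lemma meval_single [simp]: "meval x (Poly_Mapping.single m c) = c * mmon x m"
  by (simp add: meval_conv_mmon)

lemma meval_add [simp]: "meval x (F + G) = meval x F + meval x G"
  unfolding meval_conv_mmon
  by (rule setsum_keys_plus_distrib) (auto simp: algebra_simps)

lemma meval_0 [simp]: "meval x 0 = 0"
  by (simp add: meval_def)

lemma meval_1 [simp]: "meval x 1 = 1"
  using meval_single[of x 0 1] by simp

lemma meval_mult [simp]: "meval x (F * G) = meval x F * meval x G"
proof (induction F rule: mpoly_induct)
  case F: (single m c)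
  show ?case
    by (induction G rule: mpoly_induct) (simp_all add: mult_single mmon_add algebra_simps)
qed (simp add: algebra_simps)

lemma meval_power [simp]: "meval x (F ^ k) = meval x F ^ k"
  by (induction k) auto

lemma meval_sum [simp]: "meval x (\<Sum>a\<in>A. f a) = (\<Sum>a\<in>A. meval x (f a))"
  by (induction A rule: infinite_finite_induct) auto

lemma meval_diff [simp]:
  "meval x (F - G) = meval x F - meval x (G :: 'a::comm_ring_1 mpoly)"
  by (metis add_diff_cancel_right' diff_add_cancel meval_add)

lemma meval_of_nat [simp]: "meval x (of_nat k) = of_nat k"
  by (induction k) auto

lemma meval_mvar [simp]: "meval x (mvar i) = x i"
  by (simp add: mvar_def mmon_def)

lemma meval_cong:
  assumes "\<And>i. i \<in> mvars F \<Longrightarrow> x i = y i"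
  shows "meval x F = meval y F"
proof -
  have "x i = y i" if "m \<in> Poly_Mapping.keys F" "i \<in> Poly_Mapping.keys m" for m i
    using assms that by (auto simp: mvars_def)
  then show ?thesis
    unfolding meval_def by (intro sum.cong prod.cong arg_cong2[where f = "(*)"]) auto
qed

lemma mpderiv_single [simp]:
  "mpderiv i (Poly_Mapping.single m c) =
    Poly_Mapping.single (m - Poly_Mapping.single i 1) (of_nat (Poly_Mapping.lookup m i) * c)"
  by (simp add: mpderiv_def)

lemma mpderiv_add [simp]: "mpderiv i (F + G) = mpderiv i F + mpderiv i G"
  unfolding mpderiv_def
  by (rule setsum_keys_plus_distrib) (auto simp: algebra_simps single_add)

lemma mpderiv_0 [simp]: "mpderiv i 0 = 0"
  by (simp add: mpderiv_def)

lemma mpderiv_1 [simp]: "mpderiv i 1 = 0"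
  using mpderiv_single[of i 0 1] by simp

lemma mpderiv_sum [simp]: "mpderiv i (\<Sum>a\<in>A. f a) = (\<Sum>a\<in>A. mpderiv i (f a))"
  by (induction A rule: infinite_finite_induct) auto

lemma mpderiv_of_nat [simp]: "mpderiv i (of_nat k) = 0"
  by (induction k) auto

lemma mpderiv_diff [simp]:
  "mpderiv i (F - G) = mpderiv i F - mpderiv i (G :: 'a::comm_ring_1 mpoly)"
  by (metis add_diff_cancel_right' diff_add_cancel mpderiv_add)

lemma mpderiv_mult: "mpderiv i (F * G) = mpderiv i F * G + F * mpderiv i G"
proof (induction F rule: mpoly_induct)
  case F: (single m c)
  show ?case
  proof (induction G rule: mpoly_induct)
    case G: (single m' c')
    define e :: "nat \<Rightarrow>\<^sub>0 nat" where "e = Poly_Mapping.single i 1"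
    have left: "m - e + m' = m + m' - e" if "Poly_Mapping.lookup m i \<noteq> 0"
      using that by (intro poly_mapping_eqI)
        (auto simp: e_def lookup_add lookup_minus lookup_single when_def)
    have right: "m + (m' - e) = m + m' - e" if "Poly_Mapping.lookup m' i \<noteq> 0"
      using that by (intro poly_mapping_eqI)
        (auto simp: e_def lookup_add lookup_minus lookup_single when_def)
    show ?case
      using left right
      by (cases "Poly_Mapping.lookup m i = 0"; cases "Poly_Mapping.lookup m' i = 0")
        (simp_all only: mpderiv_single mult_single lookup_add flip: e_def single_add,
         simp_all add: algebra_simps flip: single_add)
  qed (simp add: algebra_simps)
qed (simp add: algebra_simps)

lemma mpderiv_power: "mpderiv i (F ^ k) = of_nat k * F ^ (k - 1) * mpderiv i F"
proof (induction k)
  case (Suc k)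
  then show ?case by (cases k) (simp_all add: mpderiv_mult algebra_simps)
qed simp

lemma mpderiv_mvar [simp]: "mpderiv j (mvar i) = (if i = j then 1 else 0)"
  by (auto simp: mvar_def lookup_single)

lemma mvars_mpderiv: "mvars (mpderiv i F) \<subseteq> mvars F"
proof -
  have "Poly_Mapping.keys (mpderiv i F) \<subseteq>
      (\<lambda>m. m - Poly_Mapping.single i 1) ` Poly_Mapping.keys F"
    unfolding mpderiv_def by (rule order_trans[OF keys_sum]) auto
  moreover have "Poly_Mapping.keys (m - Poly_Mapping.single i 1) \<subseteq> Poly_Mapping.keys m"
    for m :: "nat \<Rightarrow>\<^sub>0 nat"
    by (auto simp: in_keys_iff lookup_minus)
  ultimately show ?thesis unfolding mvars_def by blast
qed

lemma mpderiv_eq_0_if_notin_mvars: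
  assumes "i \<notin> mvars F"
  shows "mpderiv i F = 0"
  unfolding mpderiv_def using assms
  by (intro sum.neutral) (auto simp: mvars_def in_keys_iff)

text \<open>Multiplying \<open>\<partial>F/\<partial>X\<^sub>i\<close> by \<open>X\<^sub>i\<close> scales each monomial by its exponent in \<open>X\<^sub>i\<close>; these exponents add up to \<open>d\<close>.\<close>

lemma euler_identity:
  assumes "mhomogeneous d F" "mvars F \<subseteq> {..<n}"
  shows "(\<Sum>i<n. mpderiv i F * mvar i) = of_nat d * F"
proof -
  have deriv: "mpderiv i F * mvar i = (\<Sum>m\<in>Poly_Mapping.keys F.
      Poly_Mapping.single m (of_nat (Poly_Mapping.lookup m i) * Poly_Mapping.lookup F m))" for i
  proof -
    have "Poly_Mapping.single (m - Poly_Mapping.single i 1)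
        (of_nat (Poly_Mapping.lookup m i) * Poly_Mapping.lookup F m) * mvar i =
        Poly_Mapping.single m (of_nat (Poly_Mapping.lookup m i) * Poly_Mapping.lookup F m)" for m
    proof (cases "Poly_Mapping.lookup m i = 0")
      case False
      then have "m - Poly_Mapping.single i 1 + Poly_Mapping.single i 1 = m"
        by (intro poly_mapping_eqI) (auto simp: lookup_add lookup_minus lookup_single when_def)
      then show ?thesis by (simp add: mvar_def mult_single)
    qed simp
    then show ?thesis unfolding mpderiv_def by (simp add: sum_distrib_right)
  qed
  have deg: "(\<Sum>i<n. Poly_Mapping.lookup m i) = d" if "m \<in> Poly_Mapping.keys F" for m
  proof -
    have "Poly_Mapping.keys m \<subseteq> {..<n}" using that assms(2) by (auto simp: mvars_def)
    then have "(\<Sum>i<n. Poly_Mapping.lookup m i) =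
        (\<Sum>i\<in>Poly_Mapping.keys m. Poly_Mapping.lookup m i)"
      by (intro sum.mono_neutral_right) (auto simp: in_keys_iff)
    then show ?thesis using that assms(1) by (simp add: mhomogeneous_def)
  qed
  have single_sum: "(\<Sum>i\<in>A. Poly_Mapping.single m (f i)) = Poly_Mapping.single m (\<Sum>i\<in>A. f i)"
    for m :: "nat \<Rightarrow>\<^sub>0 nat" and f :: "nat \<Rightarrow> 'a" and A
    by (induction A rule: infinite_finite_induct) (auto simp: single_add)
  have expand: "F = (\<Sum>m\<in>Poly_Mapping.keys F. Poly_Mapping.single m (Poly_Mapping.lookup F m))"
    by (intro poly_mapping_eqI) (auto simp: lookup_sum lookup_single when_def in_keys_iff)
  have "(\<Sum>i<n. mpderiv i F * mvar i) = (\<Sum>m\<in>Poly_Mapping.keys F. \<Sum>i<n.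
      Poly_Mapping.single m (of_nat (Poly_Mapping.lookup m i) * Poly_Mapping.lookup F m))"
    unfolding deriv by (rule sum.swap)
  also have "\<dots> = (\<Sum>m\<in>Poly_Mapping.keys F.
      Poly_Mapping.single m (of_nat d * Poly_Mapping.lookup F m))"
    by (intro sum.cong) (simp_all add: single_sum deg flip: sum_distrib_right of_nat_sum)
  also have "\<dots> = of_nat d * (\<Sum>m\<in>Poly_Mapping.keys F.
      Poly_Mapping.single m (Poly_Mapping.lookup F m))"
    by (simp add: sum_distrib_left mult_single flip: single_of_nat)
  finally show ?thesis using expand by simp
qed

lemma lookup_mto_ac [simp]: "Poly_Mapping.lookup (mto_ac F) m = to_ac (Poly_Mapping.lookup F m)"
  by (simp add: mto_ac_def Poly_Mapping.map.rep_eq when_def)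

lemma mto_ac_eq_iff [simp]: "mto_ac F = mto_ac G \<longleftrightarrow> F = G"
  by (simp add: poly_mapping_eq_iff fun_eq_iff)

lemma mto_ac_single [simp]: "mto_ac (Poly_Mapping.single m c) = Poly_Mapping.single m (to_ac c)"
  by (simp add: mto_ac_def)

lemma mto_ac_add [simp]: "mto_ac (F + G) = mto_ac F + mto_ac G"
  by (intro poly_mapping_eqI) (simp add: lookup_add)

lemma mto_ac_0 [simp]: "mto_ac 0 = 0"
  using mto_ac_single[of 0 0] by simp

lemma mto_ac_1 [simp]: "mto_ac 1 = 1"
  using mto_ac_single[of 0 1] by simp

lemma mto_ac_diff [simp]: "mto_ac (F - G) = mto_ac F - mto_ac G"
  by (metis add_diff_cancel_right' diff_add_cancel mto_ac_add)

lemma mto_ac_mult [simp]: "mto_ac (F * G) = mto_ac F * mto_ac G"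
proof (induction F rule: mpoly_induct)
  case F: (single m c)
  show ?case
    by (induction G rule: mpoly_induct) (simp_all add: mult_single algebra_simps)
qed (simp add: algebra_simps)

lemma mto_ac_power [simp]: "mto_ac (F ^ k) = mto_ac F ^ k"
  by (induction k) auto

lemma mto_ac_sum [simp]: "mto_ac (\<Sum>a\<in>A. f a) = (\<Sum>a\<in>A. mto_ac (f a))"
  by (induction A rule: infinite_finite_induct) auto

lemma mto_ac_of_nat [simp]: "mto_ac (of_nat k) = of_nat k"
  by (induction k) auto

lemma mto_ac_mvar [simp]: "mto_ac (mvar i) = mvar i"
  by (simp add: mvar_def)

lemma mpderiv_mto_ac: "mpderiv i (mto_ac F) = mto_ac (mpderiv i F)"
  by (induction F rule: mpoly_induct) simp_all

lemma mvars_mto_ac [simp]: "mvars (mto_ac F) = mvars F"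
proof -
  have "Poly_Mapping.keys (mto_ac F) = Poly_Mapping.keys F" by (auto simp: in_keys_iff)
  then show ?thesis by (simp add: mvars_def)
qed

lemma meval_mto_ac: "meval (\<lambda>i. to_ac (b i)) (mto_ac F) = to_ac (meval b F)"
  by (induction F rule: mpoly_induct) (simp_all add: mmon_def to_ac_prod)

section \<open>Polynomials determined by their values\<close>

lemma mmon_separates:
  fixes m m' :: "nat \<Rightarrow>\<^sub>0 nat"
  assumes "infinite (UNIV :: 'a::field set)" "m \<noteq> m'"
  shows "\<exists>x :: nat \<Rightarrow> 'a. mmon x m \<noteq> mmon x m'"
proof (rule ccontr)
  assume "\<not> ?thesis"
  then have eq: "mmon x m = mmon x m'" for x :: "nat \<Rightarrow> 'a" by blast
  from assms(2) obtain j where j: "Poly_Mapping.lookup m j \<noteq> Poly_Mapping.lookup m' j"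
    using poly_mapping_eqI[of m m'] by metis
  define h :: "'a poly" where
    "h = monom 1 (Poly_Mapping.lookup m j) - monom 1 (Poly_Mapping.lookup m' j)"
  have "poly h t = 0" for t
    using eq[of "(\<lambda>i. 1)(j := t)"] by (simp add: h_def poly_monom mmon_fun_upd)
  then have "h = 0" using assms(1) poly_roots_finite[of h] by auto
  then show False using j by (simp add: h_def monom_eq_iff')
qed

text \<open>
  Artin's argument for the independence of characters: evaluating a relation at \<open>y \<cdot> x\<close> and
  subtracting \<open>mmon y m0\<close> times the relation at \<open>x\<close> removes the monomial \<open>m0\<close>.
\<close>

lemma mmon_linear_independent:
  fixes c :: "(nat \<Rightarrow>\<^sub>0 nat) \<Rightarrow> 'a::field"
  assumes "infinite (UNIV :: 'a set)" "finite S"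
    and "\<And>x. (\<Sum>m\<in>S. c m * mmon x m) = 0" "m \<in> S"
  shows "c m = 0"
  using assms(2-)
proof (induction S arbitrary: c m rule: finite_induct)
  case (insert m0 S)
  have S_zero: "c m = 0" if m: "m \<in> S" for m
  proof -
    have "c m * (mmon y m - mmon y m0) = 0" for y
    proof (rule insert.IH[OF _ m])
      fix x
      have "(\<Sum>m\<in>S. c m * (mmon y m - mmon y m0) * mmon x m) =
          (\<Sum>m\<in>insert m0 S. c m * (mmon y m - mmon y m0) * mmon x m)"
        using insert.hyps by simp
      also have "\<dots> = (\<Sum>m\<in>insert m0 S. c m * mmon (\<lambda>i. y i * x i) m)
          - mmon y m0 * (\<Sum>m\<in>insert m0 S. c m * mmon x m)"
        by (simp only: sum_distrib_left mmon_mult flip: sum_subtractf) (simp add: algebra_simps)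
      finally show "(\<Sum>m\<in>S. c m * (mmon y m - mmon y m0) * mmon x m) = 0"
        unfolding insert.prems(1) by simp
    qed
    moreover obtain y :: "nat \<Rightarrow> 'a" where "mmon y m \<noteq> mmon y m0"
      using mmon_separates[OF assms(1)] m insert.hyps by metis
    ultimately show ?thesis by force
  qed
  moreover have "c m0 = 0"
    using insert.prems(1)[of "\<lambda>i. 1"] insert.hyps S_zero by simp
  ultimately show ?case using insert.prems(2) by auto
qed simp

lemma mpoly_eqI_meval:
  fixes F G :: "'a::field mpoly"
  assumes "infinite (UNIV :: 'a set)" "\<And>x. meval x F = meval x G"
  shows "F = G"
proof -
  have "Poly_Mapping.lookup (F - G) m = 0" if "m \<in> Poly_Mapping.keys (F - G)" for m
    by (rule mmon_linear_independent[OF assms(1) _ _ that])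
      (simp_all add: assms(2) flip: meval_conv_mmon)
  then have "Poly_Mapping.lookup (F - G) m = 0" for m
    using in_keys_iff[of m "F - G"] by blast
  then have "F - G = 0" by (intro poly_mapping_eqI) simp
  then show ?thesis by simp
qed

text \<open>Over a finite field the polynomial \<open>\<Prod>\<^sub>a (X - a) + 1\<close> has no root.\<close>

lemma infinite_alg_closed: "infinite (UNIV :: 'a::alg_closed_field set)"
proof
  assume fin: "finite (UNIV :: 'a set)"
  define h :: "'a poly" where "h = (\<Prod>a\<in>UNIV. [:- a, 1:]) + 1"
  have "poly h a = 1" for a
    using fin by (simp add: h_def poly_prod prod_zero_iff)
  moreover have "degree (\<Prod>a\<in>UNIV. [:- a, 1:] :: 'a poly) = card (UNIV :: 'a set)"
    using fin by (simp add: degree_prod_sum_eq)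
  then have "degree h > 0"
    using fin by (simp add: h_def degree_add_eq_left card_gt_0_iff)
  ultimately show False using alg_closed_imp_poly_has_root[of h] by auto
qed

section \<open>Restriction to a line\<close>

lemma coeff_mult_degree_le:
  fixes f g :: "'a::comm_semiring_1 poly"
  assumes "degree f \<le> a" "degree g \<le> b"
  shows "coeff (f * g) (a + b) = coeff f a * coeff g b"
proof (cases "degree f = a \<and> degree g = b")
  case True
  then show ?thesis by (auto simp: coeff_mult_degree_sum)
next
  case False
  then have "degree f + degree g < a + b" using assms by auto
  then have "coeff (f * g) (a + b) = 0"
    using degree_mult_le[of f g] by (intro coeff_eq_0) linarith
  moreover have "coeff f a = 0 \<or> coeff g b = 0"
    using False assms by (metis coeff_eq_0 le_neq_implies_less)
  ultimately show ?thesis by auto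
qed

lemma degree_coeff_prod_le:
  fixes f :: "'b \<Rightarrow> 'a::comm_semiring_1 poly"
  assumes "\<And>i. i \<in> A \<Longrightarrow> degree (f i) \<le> e i"
  shows "degree (prod f A) \<le> sum e A \<and> coeff (prod f A) (sum e A) = (\<Prod>i\<in>A. coeff (f i) (e i))"
  using assms
proof (induction A rule: infinite_finite_induct)
  case (insert i A)
  then have IH: "degree (prod f A) \<le> sum e A"
      "coeff (prod f A) (sum e A) = (\<Prod>i\<in>A. coeff (f i) (e i))"
    and deg: "degree (f i) \<le> e i" by auto
  have "degree (f i * prod f A) \<le> e i + sum e A"
    using degree_mult_le[of "f i" "prod f A"] IH(1) deg by linarith
  then show ?case
    using insert.hyps IH deg by (simp add: coeff_mult_degree_le)
qed simp_all

text \<open>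
  The coefficient of \<open>t\<^sup>d\<close> is the value of \<open>F\<close> at the point at infinity \<open>v\<close> of the line \<open>u + t v\<close>.
  This also holds when \<open>F v = 0\<close>, so the degree of the restriction never has to be known exactly.
\<close>

lemma mhomogeneous_restrict_line:
  fixes F :: "'a::comm_semiring_1 mpoly"
  assumes "mhomogeneous d F"
  shows "\<exists>h. degree h \<le> d \<and> coeff h d = meval v F \<and> (\<forall>t. poly h t = meval (\<lambda>i. u i + t * v i) F)"
proof -
  define mon where
    "mon m = (\<Prod>i\<in>Poly_Mapping.keys m. [:u i, v i:] ^ Poly_Mapping.lookup m i)"
    for m :: "nat \<Rightarrow>\<^sub>0 nat"
  define h where "h = (\<Sum>m\<in>Poly_Mapping.keys F. smult (Poly_Mapping.lookup F m) (mon m))"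
  have lin: "degree ([:u i, v i:] ^ e) \<le> e \<and> coeff ([:u i, v i:] ^ e) e = v i ^ e" for i e
    using degree_coeff_prod_le[of "{..<e}" "\<lambda>_. [:u i, v i:]" "\<lambda>_. 1"] by simp
  have mon: "degree (mon m) \<le> d \<and> coeff (mon m) d = mmon v m" if "m \<in> Poly_Mapping.keys F" for m
  proof -
    have "(\<Sum>i\<in>Poly_Mapping.keys m. Poly_Mapping.lookup m i) = d"
      using assms that by (simp add: mhomogeneous_def)
    then show ?thesis
      using degree_coeff_prod_le[of "Poly_Mapping.keys m"
          "\<lambda>i. [:u i, v i:] ^ Poly_Mapping.lookup m i" "Poly_Mapping.lookup m"] lin
      by (simp add: mon_def mmon_def)
  qed
  have "degree h \<le> d"
    unfolding h_def using mon by (intro degree_sum_le) (auto intro: order_trans[OF degree_smult_le])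
  moreover have "coeff h d = meval v F"
    unfolding h_def meval_conv_mmon coeff_sum using mon by (intro sum.cong) auto
  moreover have "poly h t = meval (\<lambda>i. u i + t * v i) F" for t
    by (simp add: h_def mon_def meval_def poly_sum poly_prod)
  ultimately show ?thesis by blast
qed

section \<open>Rational points\<close>

text \<open>The translation \<open>x \<mapsto> x + 1\<close> permutes the ring, so it does not change the sum of all elements.\<close>

lemma of_nat_CARD_eq_0: "of_nat CARD('a) = (0 :: 'a::{ring_1, finite})"
proof -
  have "(\<Sum>x\<in>UNIV. x + 1 :: 'a) = (\<Sum>x\<in>UNIV. x)"
    by (rule sum.reindex_bij_witness[of _ "\<lambda>x. x - 1" "\<lambda>x. x + 1"]) auto
  then show ?thesis by (simp add: sum.distrib)
qed

lemma CHAR_of_CARD_prime_power: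
  assumes "prime p" "CARD('a::{field, finite}) = p ^ m"
  shows "CHAR('a) = p"
proof -
  have "CHAR('a) dvd p ^ m"
    using of_nat_CARD_eq_0[where 'a = 'a] assms(2) by (metis of_nat_eq_0_iff_char_dvd)
  moreover have "prime CHAR('a)"
    by (intro prime_CHAR_semidom finite_imp_CHAR_pos) simp
  ultimately show ?thesis
    using assms(1) by (metis prime_dvd_power primes_dvd_imp_eq)
qed

text \<open>Multiplication by \<open>x \<noteq> 0\<close> permutes the nonzero elements, so it does not change their product.\<close>

lemma power_CARD_eq_self: "x ^ CARD('a) = (x :: 'a::{field, finite})"
proof (cases "x = 0")
  case False
  let ?P = "\<Prod>y\<in>UNIV - {0 :: 'a}. y"
  have "?P = (\<Prod>y\<in>UNIV - {0}. x * y)"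
    using False by (intro prod.reindex_bij_witness[of _ "\<lambda>y. x * y" "\<lambda>y. y / x"]) auto
  also have "\<dots> = x ^ (CARD('a) - 1) * ?P" by (simp add: prod.distrib)
  finally have "x ^ (CARD('a) - 1) = 1" by simp
  then show ?thesis
    by (metis finite_UNIV_card_ge_0 finite_class.finite_UNIV mult_1 power_minus_mult)
qed simp

text \<open>
  Otherwise, on the line through \<open>(0, 1, 0, \<dots>)\<close> and \<open>(1, 0, 0, \<dots>)\<close>, the polynomial \<open>G\<^sup>r - 1\<close> of
  degree less than \<open>CARD('a)\<close> would vanish at every field element. So it is zero, which contradicts
  that its leading coefficient is the value 1 of \<open>G\<^sup>r\<close> at the point at infinity.
\<close>

lemma exists_rational_point_power_neq_1:
  fixes G :: "'a::{field, finite} mpoly"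
  assumes "mhomogeneous d G" "r * d + 1 = CARD('a)" "n \<ge> 2"
  shows "\<exists>b. (\<exists>i<n. b i \<noteq> 0) \<and> (\<forall>i\<ge>n. b i = 0) \<and> meval b G ^ r \<noteq> 1"
proof (rule ccontr)
  assume "\<not> ?thesis"
  then have one: "meval b G ^ r = 1" if "i < n" "b i \<noteq> 0" "\<forall>i\<ge>n. b i = 0" for b i
    using that by blast
  define u v :: "nat \<Rightarrow> 'a" where "u = (\<lambda>i. 0)(1 := 1)" and "v = (\<lambda>i. 0)(0 := 1)"
  obtain h where h: "degree h \<le> d" "coeff h d = meval v G"
      "\<And>t. poly h t = meval (\<lambda>i. u i + t * v i) G"
    using mhomogeneous_restrict_line[OF assms(1)] by metis
  have deg: "degree (h ^ r) \<le> r * d" "coeff (h ^ r) (r * d) = meval v G ^ r"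
    using degree_coeff_prod_le[of "{..<r}" "\<lambda>_. h" "\<lambda>_. d"] h(1,2) by auto
  have "poly (h ^ r - 1) t = 0" for t
    using one[of 1 "\<lambda>i. u i + t * v i"] assms(3) by (simp add: h(3) u_def v_def)
  moreover have "degree (h ^ r - 1) < CARD('a)"
    using degree_diff_le[OF deg(1), of 1] assms(2) by simp
  ultimately have "h ^ r - 1 = 0"
    using card_poly_roots_bound[of "h ^ r - 1"] by fastforce
  then have "coeff (h ^ r) (r * d) = coeff 1 (r * d)" by simp
  moreover have "CARD('a) > 1"
    using card_mono[of "UNIV :: 'a set" "{0, 1}"] by simp
  then have "r * d > 0" using assms(2) by linarith
  ultimately show False
    using deg(2) one[of 0 v] assms(3) by (simp add: v_def)
qed

text \<open>
  At rational points \<open>frob\<close> competes with Euler's identity. If \<open>d\<close> were not 1 in the field, the first derivatives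
  of both would show that the rational zeros of \<open>G\<close> are singular; their values show that
  \<open>G\<^bsup>k-1\<^esup>\<close> is 1 at the other rational points, which is impossible for a form of degree \<open>CARD('a) - 1\<close>.
\<close>

lemma degree_eq_1_mod_char:
  fixes G :: "'a::{field, finite} mpoly"
  assumes hom: "mhomogeneous d G" and vars: "mvars G \<subseteq> {..<n}" and "n \<ge> 2" and "d > 0"
    and k: "k * d = d - 1 + CARD('a)" and d_nz: "of_nat d \<noteq> (0 :: 'a)"
    and frob: "(\<Sum>i<n. mpderiv i G * mvar i ^ CARD('a)) = of_nat d * G ^ k"
    and smooth: "\<And>b. \<lbrakk>\<exists>i<n. b i \<noteq> 0; \<forall>i\<ge>n. b i = 0; meval b G = 0\<rbrakk> \<Longrightarrow>
      \<exists>i<n. meval b (mpderiv i G) \<noteq> 0"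
  shows "of_nat d = (1 :: 'a)"
proof (rule ccontr)
  assume d_ne_1: "of_nat d \<noteq> (1 :: 'a)"
  have CARD: "CARD('a) > 1"
    using card_mono[of "UNIV :: 'a set" "{0, 1}"] by simp
  \<comment> \<open>For \<open>k = 1\<close> the equation for \<open>k d\<close> would give a field with one element.\<close>
  have k2: "k \<ge> 2"
  proof (rule ccontr)
    assume "\<not> k \<ge> 2"
    then have "k = 0 \<or> k = 1" by auto
    then show False using k CARD \<open>d > 0\<close> by auto
  qed
  have q0: "of_nat CARD('a) = (0 :: 'a mpoly)"
    by (metis of_nat_CARD_eq_0 single_of_nat single_zero)
  have euler: "(\<Sum>i<n. mpderiv i G * mvar i) = of_nat d * G"
    using euler_identity[OF hom vars] .
  have nonzero: "meval b G \<noteq> 0" if b: "\<exists>i<n. b i \<noteq> 0" "\<forall>i\<ge>n. b i = 0" for b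
  proof
    assume G0: "meval b G = 0"
    \<comment> \<open>The contraction of the Hessian with \<open>b\<close> is computed from \<open>frob\<close> and from Euler's identity.\<close>
    have "meval b (mpderiv j G) = 0" if "j < n" for j
    proof -
      have "mpderiv j (\<Sum>i<n. mpderiv i G * mvar i ^ CARD('a)) = mpderiv j (of_nat d * G ^ k)"
        using frob by simp
      then have "(\<Sum>i<n. mpderiv j (mpderiv i G) * mvar i ^ CARD('a)) =
          of_nat d * (of_nat k * G ^ (k - 1) * mpderiv j G)"
        by (simp add: mpderiv_mult mpderiv_power q0)
      from arg_cong[OF this, of "meval b"]
      have "(\<Sum>i<n. meval b (mpderiv j (mpderiv i G)) * b i ^ CARD('a)) = 0"
        using G0 k2 by (simp add: zero_power)
      then have hess: "(\<Sum>i<n. meval b (mpderiv j (mpderiv i G)) * b i) = 0"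
        by (simp add: power_CARD_eq_self)
      have "of_nat d * mpderiv j G = mpderiv j (\<Sum>i<n. mpderiv i G * mvar i)"
        unfolding euler by (simp add: mpderiv_mult)
      also have "\<dots> = (\<Sum>i<n. mpderiv j (mpderiv i G) * mvar i +
          (if i = j then mpderiv i G else 0))"
        unfolding mpderiv_sum by (intro sum.cong) (simp_all add: mpderiv_mult)
      also have "\<dots> = (\<Sum>i<n. mpderiv j (mpderiv i G) * mvar i) + mpderiv j G"
        using that by (simp add: sum.distrib)
      finally have "of_nat d * mpderiv j G =
          (\<Sum>i<n. mpderiv j (mpderiv i G) * mvar i) + mpderiv j G" .
      from arg_cong[OF this, of "meval b"] show ?thesis
        using hess d_ne_1 by simp
    qed
    then show False using smooth[OF b G0] by blast
  qed
  have "meval b G ^ (k - 1) = 1" if b: "\<exists>i<n. b i \<noteq> 0" "\<forall>i\<ge>n. b i = 0" for b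
  proof -
    have "of_nat d * meval b G = of_nat d * meval b G ^ k"
      using arg_cong[OF euler, of "meval b"] arg_cong[OF frob, of "meval b"]
      by (simp add: power_CARD_eq_self)
    then have "meval b G * meval b G ^ (k - 1) = meval b G * 1"
      using d_nz k2 by (simp flip: power_Suc)
    then show ?thesis using nonzero[OF b] by simp
  qed
  moreover have "(k - 1) * d + 1 = CARD('a)"
    using k k2 \<open>d > 0\<close> CARD by (simp add: diff_mult_distrib)
  ultimately show False
    using exists_rational_point_power_neq_1[OF hom _ \<open>n \<ge> 2\<close>] by blast
qed

section \<open>Roots over an algebraically closed field\<close>

text \<open>
  In any characteristic one can split off a linear factor \<open>X - a\<close>: the derivative of \<open>f = (X - a) g\<close> takes the value \<open>g(a)\<close> at \<open>a\<close> and
  \<open>(b - a) g'(b)\<close> at another root \<open>b\<close>, so the hypothesis passes to \<open>g\<close> and \<open>a\<close> is not counted twice.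
\<close>

lemma card_roots_eq_degree:
  fixes f :: "'a::alg_closed_field poly"
  assumes "f \<noteq> 0" "\<And>a. poly f a = 0 \<Longrightarrow> poly (pderiv f) a \<noteq> 0"
  shows "card {a. poly f a = 0} = degree f"
  using assms
proof (induction "degree f" arbitrary: f)
  case 0
  then obtain c where "f = [:c:]" by (metis degree_eq_zeroE)
  then show ?case using 0 by simp
next
  case (Suc d)
  then obtain a where a: "poly f a = 0"
    using alg_closed_imp_poly_has_root[of f] by auto
  then obtain g where f: "f = [:- a, 1:] * g" by (metis dvdE poly_eq_0_iff_dvd)
  have g: "g \<noteq> 0" using f Suc.prems(1) by auto
  then have deg: "degree f = Suc (degree g)"
    unfolding f by (subst degree_mult_eq) auto
  have pderiv_f: "pderiv f = g + [:- a, 1:] * pderiv g"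
    unfolding f by (subst pderiv_mult) (simp add: pderiv_pCons algebra_simps)
  have ga: "poly g a \<noteq> 0"
    using Suc.prems(2)[OF a] by (simp add: pderiv_f)
  have "card {b. poly g b = 0} = degree g"
  proof (rule Suc.hyps(1)[OF _ g])
    show "d = degree g" using deg Suc.hyps(2) by simp
    fix b assume b: "poly g b = 0"
    then have "poly f b = 0" by (simp add: f)
    then have "poly (pderiv f) b \<noteq> 0" by (rule Suc.prems(2))
    then show "poly (pderiv g) b \<noteq> 0" using b by (auto simp: pderiv_f)
  qed
  moreover have "{b. poly f b = 0} = insert a {b. poly g b = 0}"
    by (auto simp: f)
  ultimately show ?case
    using ga deg poly_roots_finite[OF g] by simp
qed

lemma card_nth_roots_alg_closed:
  fixes c :: "'a::alg_closed_field"
  assumes "of_nat d \<noteq> (0 :: 'a)" "c \<noteq> 0"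
  shows "card {y. y ^ d = c} = d"
proof -
  have d: "d > 0" using assms(1) by (cases d) auto
  define f where "f = monom 1 d + [:- c:]"
  have poly_f: "poly f y = y ^ d - c" for y by (simp add: f_def poly_monom)
  have deg: "degree f = d"
    using d unfolding f_def by (simp add: degree_add_eq_left degree_monom_eq)
  have "card {y. poly f y = 0} = degree f"
  proof (rule card_roots_eq_degree)
    show "f \<noteq> 0" using deg d by auto
    fix y assume "poly f y = 0"
    then have "y \<noteq> 0" using assms(2) d by (auto simp: poly_f)
    then show "poly (pderiv f) y \<noteq> 0"
      using assms(1) by (simp add: f_def pderiv_add pderiv_monom pderiv_pCons poly_monom)
  qed
  then show ?thesis by (simp add: poly_f deg)
qed

text \<open>
  Write \<open>e = s d + r\<close> with \<open>r < d\<close>. The \<open>d\<close> distinct \<open>d\<close>-th roots of \<open>c\<close> are zeros of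
  \<open>a c\<^sup>s Y\<^sup>r - b\<close>, which for \<open>r > 0\<close> would have degree \<open>r\<close>.
\<close>

lemma dvd_if_power_constant_on_nth_roots:
  fixes c a b :: "'a::alg_closed_field"
  assumes d: "of_nat d \<noteq> (0 :: 'a)" and "c \<noteq> 0" "a \<noteq> 0"
    and const: "\<And>y. y ^ d = c \<Longrightarrow> a * y ^ e = b"
  shows "d dvd e"
proof (rule ccontr)
  assume "\<not> d dvd e"
  then have r: "e mod d > 0" by (simp add: mod_greater_zero_iff_not_dvd)
  have "d > 0" using d by (cases d) auto
  define f where "f = monom (a * c ^ (e div d)) (e mod d) + [:- b:]"
  have "a * c ^ (e div d) \<noteq> 0" using assms by simp
  then have deg: "degree f = e mod d"
    using r unfolding f_def by (simp add: degree_add_eq_left degree_monom_eq)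
  have "poly f y = 0" if "y ^ d = c" for y
  proof -
    have "y ^ e = c ^ (e div d) * y ^ (e mod d)"
      by (metis that mult_div_mod_eq power_add power_mult)
    then show ?thesis using const[OF that] by (simp add: f_def poly_monom mult.assoc)
  qed
  then have "{y. y ^ d = c} \<subseteq> {y. poly f y = 0}" by auto
  moreover have f: "f \<noteq> 0" using deg r by auto
  ultimately have "card {y. y ^ d = c} \<le> card {y. poly f y = 0}"
    by (intro card_mono poly_roots_finite)
  also have "\<dots> \<le> degree f" by (rule card_poly_roots_bound[OF f])
  finally have "d \<le> e mod d"
    using card_nth_roots_alg_closed[OF d \<open>c \<noteq> 0\<close>] deg by simp
  then show False using mod_less_divisor[OF \<open>d > 0\<close>, of e] by linarith
qed

text \<open>
  A function on the base that equals a multiple of a power of the coordinate \<open>x\<^sub>n\<close> on the cover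
  \<open>x\<^sub>n\<^sup>d = G\<close> is unchanged under multiplication of \<open>x\<^sub>n\<close> by roots of unity, so that power is a power of \<open>x\<^sub>n\<^sup>d\<close>.
  That \<open>G\<close> and \<open>A\<close> live on the base is expressed by their values being independent of \<open>x\<^sub>n\<close>.
\<close>

lemma eq_power_if_on_cyclic_cover:
  fixes G A :: "'a::alg_closed_field mpoly"
  assumes d: "of_nat d \<noteq> (0 :: 'a)" and "G \<noteq> 0"
    and G: "\<And>x y. meval (x(n := y)) G = meval x G"
    and A: "\<And>x y. meval (x(n := y)) A = meval x A"
    and cover: "\<And>x. meval x G = x n ^ d \<Longrightarrow> meval x A = of_nat d * x n ^ e"
  shows "\<exists>k. k * d = e \<and> A = of_nat d * G ^ k"
proof -
  have A_root: "of_nat d * y ^ e = meval x A" if "y ^ d = meval x G" for x y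
    using cover[of "x(n := y)"] that by (simp add: G A)
  obtain x where "meval x G \<noteq> 0"
    using mpoly_eqI_meval[OF infinite_alg_closed, of G 0] \<open>G \<noteq> 0\<close> by auto
  then have "d dvd e"
    using dvd_if_power_constant_on_nth_roots[OF d _ d A_root] by blast
  then obtain k where k: "e = d * k" by auto
  have "d > 0" using d by (cases d) auto
  have "A = of_nat d * G ^ k"
  proof (rule mpoly_eqI_meval[OF infinite_alg_closed])
    fix x
    obtain y where y: "y ^ d = meval x G" using nth_root_exists[OF \<open>d > 0\<close>] by blast
    show "meval x A = meval x (of_nat d * G ^ k)"
      using A_root[OF y] by (simp add: k power_mult y)
  qed
  then show ?thesis using k by (auto simp: mult.commute)
qed

section \<open>The tangent hyperplane of a cyclic cover\<close>

text \<open>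
  The Frobenius image of a point is again a point, because \<open>x\<^sub>i \<mapsto> x\<^sub>i\<^sup>q\<close> preserves zero and nonzero
  coordinates. So only the equation of the tangent hyperplane matters.
\<close>

lemma frobenius_nonclassicalI:
  assumes "q > 0" "\<And>x. x \<in> hypersurface N F \<Longrightarrow>
    (\<Sum>i\<le>N. meval x (mpderiv i (mto_ac F)) * x i ^ q) = 0"
  shows "frobenius_nonclassical q N F"
  using assms
  by (auto simp: frobenius_nonclassical_def tangent_hyperplane_def frobenius_map_def
      hypersurface_def proj_coords_def zero_power)

lemma frobenius_nonclassical_smoothD:
  assumes "frobenius_nonclassical q N F" "smooth_hypersurface N F" "x \<in> hypersurface N F"
  shows "(\<Sum>i\<le>N. meval x (mpderiv i (mto_ac F)) * x i ^ q) = 0"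
  using assms
  by (auto simp: frobenius_nonclassical_def smooth_hypersurface_def tangent_hyperplane_def
      frobenius_map_def)

lemma meval_mpderiv_cyclic_cover:
  fixes G :: "'a::comm_ring_1 mpoly"
  assumes "n \<notin> mvars G"
  shows "meval x (mpderiv i (G - mvar n ^ d)) =
    (if i = n then - of_nat d * x n ^ (d - 1) else meval x (mpderiv i G))"
  using mpderiv_eq_0_if_notin_mvars[OF assms] by (simp add: mpderiv_power)

lemma frobenius_tangent_sum_cyclic_cover:
  fixes G :: "'a::comm_ring_1 mpoly"
  assumes "n \<notin> mvars G"
  shows "(\<Sum>i\<le>n. meval x (mpderiv i (G - mvar n ^ d)) * x i ^ q) =
    meval x (\<Sum>i<n. mpderiv i G * mvar i ^ q) - of_nat d * x n ^ (d - 1 + q)"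
  unfolding lessThan_Suc_atMost[symmetric]
  by (simp add: meval_mpderiv_cyclic_cover[OF assms] power_add algebra_simps del: mpderiv_diff)

text \<open>
  A point of the branch locus lies on the cover with \<open>x\<^sub>n = 0\<close>. There \<open>\<partial>F/\<partial>X\<^sub>n = - d X\<^sub>n\<^bsup>d-1\<^esup>\<close> vanishes, as
  \<open>d \<ge> 2\<close>, so a nonzero partial derivative must come from \<open>G\<close>.
\<close>

lemma smooth_branch_locus:
  assumes smooth: "smooth_hypersurface n (G - mvar n ^ d)" and "n \<notin> mvars G" "d \<ge> 2"
    and x: "\<exists>i<n. x i \<noteq> 0" "\<forall>i\<ge>n. x i = 0" "meval x (mto_ac G) = 0"
  shows "\<exists>i<n. meval x (mpderiv i (mto_ac G)) \<noteq> 0"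
proof -
  have "x \<in> hypersurface n (G - mvar n ^ d)"
    using x \<open>d \<ge> 2\<close> by (auto simp: hypersurface_def proj_coords_def intro: less_imp_le)
  then obtain i where i: "i \<le> n" "meval x (mpderiv i (mto_ac G - mvar n ^ d)) \<noteq> 0"
    using smooth by (auto simp: smooth_hypersurface_def nonsingular_at_def)
  then have "i \<noteq> n" "meval x (mpderiv i (mto_ac G)) \<noteq> 0"
    using x(2) \<open>n \<notin> mvars G\<close> \<open>d \<ge> 2\<close>
    by (auto simp: meval_mpderiv_cyclic_cover simp del: mpderiv_diff split: if_splits)
  then show ?thesis using i(1) by (meson le_neq_implies_less)
qed

section \<open>The characterisation\<close>

theorem theorem4p1:
  fixes F G :: "'a::{field, finite} mpoly"
    and n d p q m :: nat
  assumes "n \<ge> 2"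
    and "prime p" and "m \<ge> 1" and "q = p ^ m" and "CARD('a) = q"
    and "mvars F \<subseteq> {..n}" and "mhomogeneous d F" and "d > 2"
    and "absolutely_irreducible F" and "smooth_hypersurface n F"
    and "mvars G \<subseteq> {..<n}" and "F = G - mvar n ^ d"
    and "\<not> p dvd d"
    and "(\<Sum>i\<le>n. mpderiv i F * mvar i ^ q) \<noteq> 0"
  shows "(frobenius_nonclassical q n F \<longleftrightarrow>
            (\<exists>k::nat. k > 0 \<and> k * d = d - 1 + q \<and> p dvd k \<and>
               G ^ k = (\<Sum>i<n. mpderiv i G * mvar i ^ q)))
         \<and> (frobenius_nonclassical q n F \<longrightarrow> frobenius_nonclassical q (n - 1) G)"
proof -
  define A where "A = (\<Sum>i<n. mpderiv i G * mvar i ^ q)"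
  have A_ac: "(\<Sum>i<n. mpderiv i (mto_ac G) * mvar i ^ q) = mto_ac A"
    by (simp add: A_def mpderiv_mto_ac)
  have q: "q > 0" using assms(2,4) by (simp add: prime_gt_0_nat)
  have char: "CHAR('a) = p" using CHAR_of_CARD_prime_power assms(2,4,5) by blast
  have d_nz: "of_nat d \<noteq> (0 :: 'a)" "of_nat d \<noteq> (0 :: 'a alg_closure)"
    using assms(13) by (simp_all add: of_nat_eq_0_iff_char_dvd char)
  have n_notin: "n \<notin> mvars G" using assms(11) by auto
  have branch: "\<exists>i<n. meval x (mpderiv i (mto_ac G)) \<noteq> 0"
    if "\<exists>i<n. x i \<noteq> 0" "\<forall>i\<ge>n. x i = 0" "meval x (mto_ac G) = 0" for x
    using smooth_branch_locus[OF _ n_notin _ that] assms(8,10,12) by simp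
  \<comment> \<open>For \<open>G = 0\<close> every point of the hyperplane \<open>X\<^sub>n = 0\<close> would be singular.\<close>
  have "G \<noteq> 0"
  proof
    assume "G = 0"
    moreover have "\<exists>i<n. (if i = 0 then 1 else 0 :: 'a alg_closure) \<noteq> 0"
      using assms(1) by (intro exI[of _ 0]) auto
    ultimately show False
      using branch[of "\<lambda>i. if i = 0 then 1 else 0"] assms(1) by auto
  qed
  have hom: "mhomogeneous d G"
  proof -
    have "G = F + Poly_Mapping.single (Poly_Mapping.single n d) 1"
    proof -
      have "mvar n ^ e = Poly_Mapping.single (Poly_Mapping.single n e) (1 :: 'a)" for e
        by (induction e) (simp_all add: mvar_def mult_single flip: single_add)
      then show ?thesis using assms(12) by simp
    qed
    then have "Poly_Mapping.keys G \<subseteq> Poly_Mapping.keys F \<union> {Poly_Mapping.single n d}"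
      using keys_add[of F "Poly_Mapping.single (Poly_Mapping.single n d) 1"] by simp
    then show ?thesis
      using assms(7,8) unfolding mhomogeneous_def by auto
  qed
  have tangent: "(\<Sum>i\<le>n. meval x (mpderiv i (mto_ac F)) * x i ^ q) =
      meval x (mto_ac A) - of_nat d * x n ^ (d - 1 + q)" for x
    using frobenius_tangent_sum_cyclic_cover[of n "mto_ac G" x d q] n_notin
    by (simp add: assms(12) flip: A_ac)
  have forward: "\<exists>k>0. k * d = d - 1 + q \<and> p dvd k \<and> G ^ k = A"
    if nonclassical: "frobenius_nonclassical q n F"
  proof -
    have upd_deriv: "meval (x(n := y)) (mpderiv i (mto_ac G)) = meval x (mpderiv i (mto_ac G))"
      for x y i
      using n_notin mvars_mpderiv[of i "mto_ac G"] by (intro meval_cong) auto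
    have upd_G: "meval (x(n := y)) (mto_ac G) = meval x (mto_ac G)" for x y
      using n_notin by (intro meval_cong) auto
    have upd_A: "meval (x(n := y)) (mto_ac A) = meval x (mto_ac A)" for x y
      by (simp add: upd_deriv flip: A_ac)
    have "\<exists>k. k * d = d - 1 + q \<and> mto_ac A = of_nat d * mto_ac G ^ k"
    proof (rule eq_power_if_on_cyclic_cover[OF d_nz(2) _ upd_G upd_A])
      show "mto_ac G \<noteq> 0" using \<open>G \<noteq> 0\<close> by (metis mto_ac_0 mto_ac_eq_iff)
      fix x :: "nat \<Rightarrow> 'a alg_closure"
      assume x: "meval x (mto_ac G) = x n ^ d"
      \<comment> \<open>Points have coordinate zero beyond \<open>n\<close>, and not all coordinates zero. Cutting off \<open>x\<close>
        changes none of the values involved, and at the origin both sides vanish.\<close>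
      define z where "z i = (if i \<le> n then x i else 0)" for i
      have "meval z (mto_ac G) = meval x (mto_ac G)"
        using assms(11) by (intro meval_cong) (auto simp: z_def)
      then have zF: "meval z (mto_ac F) = 0"
        using x by (simp add: assms(12) z_def)
      have "meval z (mpderiv i (mto_ac G)) = meval x (mpderiv i (mto_ac G))" for i
        using assms(11) mvars_mpderiv[of i "mto_ac G"] by (intro meval_cong) (auto simp: z_def)
      then have zA: "meval z (mto_ac A) = meval x (mto_ac A)"
        by (simp add: z_def flip: A_ac)
      have "meval z (mto_ac A) - of_nat d * z n ^ (d - 1 + q) = 0"
      proof (cases "z \<in> proj_coords n")
        case True
        then have "z \<in> hypersurface n F" using zF by (simp add: hypersurface_def)
        then show ?thesis
          using frobenius_nonclassical_smoothD[OF nonclassical assms(10)] tangent by metis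
      next
        case False
        then have "z i = 0" if "i \<le> n" for i
          using that by (auto simp: proj_coords_def z_def)
        then show ?thesis using q by (simp add: zero_power flip: A_ac)
      qed
      then show "meval x (mto_ac A) = of_nat d * x n ^ (d - 1 + q)"
        by (simp add: zA z_def)
    qed
    then obtain k where k: "k * d = d - 1 + q" and "mto_ac A = mto_ac (of_nat d * G ^ k)"
      by auto
    then have A_eq: "A = of_nat d * G ^ k" by (simp only: mto_ac_eq_iff)
    have d1: "of_nat d = (1 :: 'a)"
    proof (rule degree_eq_1_mod_char[OF hom assms(11,1)])
      show "d > 0" using assms(8) by simp
      show "k * d = d - 1 + CARD('a)" using k assms(5) by simp
      show "(\<Sum>i<n. mpderiv i G * mvar i ^ CARD('a)) = of_nat d * G ^ k"
        using A_eq assms(5) by (simp add: A_def)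
      fix b :: "nat \<Rightarrow> 'a"
      assume "\<exists>i<n. b i \<noteq> 0" "\<forall>i\<ge>n. b i = 0" "meval b G = 0"
      then have "\<exists>i<n. meval (\<lambda>i. to_ac (b i)) (mpderiv i (mto_ac G)) \<noteq> 0"
        by (intro branch) (simp_all add: meval_mto_ac)
      then show "\<exists>i<n. meval b (mpderiv i G) \<noteq> 0"
        by (simp add: mpderiv_mto_ac meval_mto_ac)
    qed (use d_nz in simp_all)
    then have "of_nat d = (1 :: 'a mpoly)" by (metis single_of_nat single_one)
    then have "G ^ k = A" using A_eq by simp
    moreover have "p dvd k"
    proof -
      have "of_nat (d - 1) = (0 :: 'a)" using d1 assms(8) by (simp add: of_nat_diff)
      then have "p dvd d - 1" by (simp add: of_nat_eq_0_iff_char_dvd char)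
      then have "p dvd k * d" using k assms(3,4) by (simp add: dvd_power)
      then show ?thesis using assms(2,13) prime_dvd_mult_iff by blast
    qed
    moreover have "k > 0" using k q by (cases k) auto
    ultimately show ?thesis using k by blast
  qed
  have backward: "frobenius_nonclassical q n F"
    if k: "k * d = d - 1 + q" "p dvd k" "G ^ k = A" for k
  proof (rule frobenius_nonclassicalI[OF q])
    fix x assume "x \<in> hypersurface n F"
    then have x: "meval x (mto_ac G) = x n ^ d" by (simp add: hypersurface_def assms(12))
    have "p dvd d - 1 + q" using k by (metis dvd_mult2)
    then have "p dvd d - 1" using assms(3,4) by (simp add: dvd_add_left_iff dvd_power)
    then have "of_nat (d - 1) = (0 :: 'a alg_closure)"
      by (simp add: of_nat_eq_0_iff_char_dvd char)
    then have "of_nat d = (1 :: 'a alg_closure)" using assms(8) by (simp add: of_nat_diff)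
    moreover have "meval x (mto_ac A) = x n ^ (d - 1 + q)"
      using k(1) x by (simp flip: k(3) power_mult) (simp add: mult.commute)
    ultimately show "(\<Sum>i\<le>n. meval x (mpderiv i (mto_ac F)) * x i ^ q) = 0"
      by (simp add: tangent)
  qed
  have branch_nonclassical: "frobenius_nonclassical q (n - 1) G" if "k > 0" "G ^ k = A" for k
  proof (rule frobenius_nonclassicalI[OF q])
    fix x assume "x \<in> hypersurface (n - 1) G"
    then have "meval x (mto_ac G) = 0" by (simp add: hypersurface_def)
    then have "meval x (mto_ac A) = 0" using that by (simp add: zero_power flip: that(2))
    moreover have "{..n - 1} = {..<n}" using assms(1) by auto
    ultimately show "(\<Sum>i\<le>n - 1. meval x (mpderiv i (mto_ac G)) * x i ^ q) = 0"
      by (simp flip: A_ac)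
  qed
  show ?thesis
    using forward backward branch_nonclassical unfolding A_def by blast
qed

end
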